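(* Let $N$ be a finite set with $|N|\geq 2$. Let $\mathsf{J}$ be the polyhedron of real vectors $\eta=(\eta(i|B))_{i\in N,\,B\subseteq N\setminus\{i\}}$ satisfying (a) $\eta(i|B)\geq 0$ for all $i\in N$, $B\subseteq N\setminus\{i\}$; (b) $\sum_{B\subseteq N\setminus\{j\}}\eta(j|B)=1$ for all $j\in N$; (c) $\sum_{i\in C}\sum_{D\subseteq N\setminus C}\eta(i|D)\geq 1$ for all $C\subseteq N$ with $|C|\geq 2$. Consider the following constraints on $u\in\mathbb{R}^{\mathcal{P}(N)}$: (d) $\sum_{T\subseteq N}u(T)=0$ and $\sum_{T\subseteq N,\,j\in T}u(T)=0$ for every $j\in N$; (e) $\sum_{T\in\mathcal{A}}u(T)\leq 1$ for every non-empty class $\mathcal{A}$ of non-empty subsets of $N$ which is closed under supersets; (f) $\sum_{T\subseteq N}m(T)\,u(T)\geq 0$ for every $m\in\mathcal{M}(N)$; (g) $\sum_{T\subseteq N,\,|C\cap T|\geq 2}u(T)\cdot(|C\cap T|-1)\geq 0$ for every $C\subseteq N$ with $|C|\geq 2$. Then the image of $\mathsf{J}$ under the mapping $\eta\mapsto u^{\eta}$ is the polyhedron $\{u\in\mathbb{R}^{\mathcal{P}(N)};\ u\text{ satisfies (d), (e), (g)}\}$, and the polyhedron $\{u\in\mathbb{R}^{\mathcal{P}(N)};\ u\text{ satisfies (d), (e), (f)}\}$ is contained in this image.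
   Context: $\mathcal{P}(N)$ is the power set of $N$. For $A\subseteq N$, $\delta_A(S)=1$ if $S=A$ and $\delta_A(S)=0$ for $S\subseteq N$, $S\neq A$. A class $\mathcal{A}$ of subsets of $N$ is closed under supersets if $S\in\mathcal{A}$, $S\subseteq T\subseteq N$ implies $T\in\mathcal{A}$. The mapping $\eta\mapsto u^{\eta}$ assigns to a vector $\eta=(\eta(i|B))_{i\in N,\,B\subseteq N\setminus\{i\}}$ the vector $u^{\eta}\in\mathbb{R}^{\mathcal{P}(N)}$ given for $T\subseteq N$ by $$u^{\eta}(T)=\delta_N(T)-\delta_{\emptyset}(T)+\sum_{i\in N}\sum_{B\subseteq N\setminus\{i\}}\eta(i|B)\cdot\{\delta_B(T)-\delta_{\{i\}\cup B}(T)\}.$$ A function $m:\mathcal{P}(N)\to\mathbb{R}$ is supermodular if $m(E\cup F)+m(E\cap F)\geq m(E)+m(F)$ for all $E,F\subseteq N$; it is standardized if $m(T)=0$ whenever $|T|\leq 1$. The standardized supermodular functions form a pointed rational polyhedral cone in $\mathbb{R}^{\mathcal{P}(N)}$. Each extreme ray of this cone contains a unique non-zero lattice point (integer vector) whose components have no common prime divisor; $\mathcal{M}(N)$ denotes the finite set of these representatives of the extreme rays. *)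

theory Defs
  imports "HOL-Analysis.Analysis" "HOL-Computational_Algebra.Primes"
begin

text \<open>
  The finite ground set \<open>N\<close> is the universe of a type \<open>'n::finite\<close>, so that the power set of \<open>N\<close>
  is the type \<open>'n set\<close> and vectors indexed by subsets of \<open>N\<close> are elements of the Euclidean
  space \<open>real ^ 'n set\<close>.
\<close>

definition delta :: "'n set \<Rightarrow> 'n set \<Rightarrow> real" where
  "delta A S = (if S = A then 1 else 0)"

text \<open>
  A vector \<open>\<eta>\<close> has the component \<open>\<eta> $ (i, B)\<close> for \<open>\<eta>(i|B)\<close>.  The index type contains
  also the pairs with \<open>i \<in> B\<close>, which are not part of the index set; \<open>eta_space\<close> is the
  coordinate subspace where these superfluous components vanish.
\<close>

definition eta_space :: "(real ^ ('n::finite \<times> 'n set)) set" where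
  "eta_space = {\<eta>. \<forall>i B. i \<in> B \<longrightarrow> \<eta> $ (i, B) = 0}"

definition u_of :: "real ^ ('n::finite \<times> 'n set) \<Rightarrow> real ^ 'n set" where
  "u_of \<eta> = (\<chi> T. delta UNIV T - delta {} T
      + (\<Sum>i\<in>UNIV. \<Sum>B\<in>Pow (UNIV - {i}).
           \<eta> $ (i, B) * (delta B T - delta ({i} \<union> B) T)))"

definition J_polyhedron :: "(real ^ ('n::finite \<times> 'n set)) set" where
  "J_polyhedron = {\<eta> \<in> eta_space.
      (\<forall>i. \<forall>B\<in>Pow (UNIV - {i}). \<eta> $ (i, B) \<ge> 0) \<and>
      (\<forall>j. (\<Sum>B\<in>Pow (UNIV - {j}). \<eta> $ (j, B)) = 1) \<and>
      (\<forall>C. card C \<ge> 2 \<longrightarrow> (\<Sum>i\<in>C. \<Sum>D\<in>Pow (UNIV - C). \<eta> $ (i, D)) \<ge> 1)}"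

definition closed_under_supersets :: "'n set set \<Rightarrow> bool" where
  "closed_under_supersets \<A> \<longleftrightarrow> (\<forall>S T. S \<in> \<A> \<and> S \<subseteq> T \<longrightarrow> T \<in> \<A>)"

definition supermodular :: "real ^ 'n::finite set \<Rightarrow> bool" where
  "supermodular m \<longleftrightarrow> (\<forall>E F. m $ (E \<union> F) + m $ (E \<inter> F) \<ge> m $ E + m $ F)"

definition standardized :: "real ^ 'n::finite set \<Rightarrow> bool" where
  "standardized m \<longleftrightarrow> (\<forall>T. card T \<le> 1 \<longrightarrow> m $ T = 0)"

definition supermodular_cone :: "(real ^ 'n::finite set) set" where
  "supermodular_cone = {m. standardized m \<and> supermodular m}"

definition extreme_ray_of :: "'a::real_vector set \<Rightarrow> 'a set \<Rightarrow> bool"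
    (infixr \<open>extreme'_ray'_of\<close> 50) where
  "R extreme_ray_of K \<longleftrightarrow> R face_of K \<and> (\<exists>x. x \<noteq> 0 \<and> R = conic hull {x})"

definition primitive_lattice_point :: "real ^ 'k::finite \<Rightarrow> bool" where
  "primitive_lattice_point m \<longleftrightarrow>
     m \<noteq> 0 \<and>
     (\<exists>z :: 'k \<Rightarrow> int. (\<forall>k. m $ k = of_int (z k)) \<and> \<not> (\<exists>p. prime p \<and> (\<forall>k. p dvd z k)))"

definition extreme_supermodular :: "(real ^ 'n::finite set) set" where
  "extreme_supermodular =
     {m. primitive_lattice_point m \<and> (\<exists>R. R extreme_ray_of supermodular_cone \<and> m \<in> R)}"

definition zero_sum_constraints :: "real ^ 'n::finite set \<Rightarrow> bool" where
  "zero_sum_constraints u \<longleftrightarrow>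
     (\<Sum>T\<in>UNIV. u $ T) = 0 \<and> (\<forall>j. (\<Sum>T | j \<in> T. u $ T) = 0)"

definition superset_class_constraints :: "real ^ 'n::finite set \<Rightarrow> bool" where
  "superset_class_constraints u \<longleftrightarrow>
     (\<forall>\<A>. \<A> \<noteq> {} \<and> {} \<notin> \<A> \<and> closed_under_supersets \<A> \<longrightarrow> (\<Sum>T\<in>\<A>. u $ T) \<le> 1)"

definition supermodular_constraints :: "real ^ 'n::finite set \<Rightarrow> bool" where
  "supermodular_constraints u \<longleftrightarrow>
     (\<forall>m\<in>extreme_supermodular. (\<Sum>T\<in>UNIV. m $ T * u $ T) \<ge> 0)"

definition cluster_constraints :: "real ^ 'n::finite set \<Rightarrow> bool" where
  "cluster_constraints u \<longleftrightarrow>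
     (\<forall>C. card C \<ge> 2 \<longrightarrow>
        (\<Sum>T | card (C \<inter> T) \<ge> 2. u $ T * (real (card (C \<inter> T)) - 1)) \<ge> 0)"

end

theory Submission
  imports Defs
begin

text \<open>
  Draw the subsets of \<open>N\<close> as the vertices of a directed graph with an arc from \<open>B\<close> to
  \<open>{i} \<union> B\<close> for every \<open>i \<notin> B\<close>, and read \<open>\<eta>(i|B)\<close> as the amount of flow on this arc.  Up to the
  fixed vector \<open>\<delta>\<^sub>N - \<delta>\<^sub>\<emptyset>\<close>, the vector \<open>u\<^sup>\<eta>\<close> records outflow minus inflow (the divergence) at every
  vertex.  Every linear functional of \<open>u\<^sup>\<eta>\<close> with weights \<open>w(T)\<close> therefore is a sum over arcs of
  \<open>\<eta>(i|B) (w(B) - w({i} \<union> B))\<close> plus \<open>w(N) - w(\<emptyset>)\<close> (\<open>sum_mult_u_of\<close>), and each family of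
  constraints on \<open>u\<close> comes from one choice of weights:

  \<^item> \<open>w(T) = 1\<close> and \<open>w(T) = [j \<in> T]\<close> turn (d) into a triviality and the normalisation (b);
  \<^item> the indicator of a class closed under supersets turns (e) into the statement that the total
    flow into the class is non-negative, a consequence of (a);
  \<^item> \<open>w(T) = max(0, |C \<inter> T| - 1)\<close> turns (g), in the presence of (b), into (c).

  So the image of \<open>\<J>\<close> satisfies (d), (e) and (g), and conversely only the existence of \<open>\<eta> \<ge> 0\<close>
  with a prescribed divergence remains.  This is Gale's feasibility theorem for flows on a
  partially ordered set (\<open>divergence_surj\<close>): by Farkas' lemma an obstruction is an antitone
  weight function with negative weighted sum, and a layer-cake decomposition of monotone functions
  into indicators of up-sets (\<open>sum_mono_mult_nonpos\<close>) reduces the obstructions to those excluded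
  by (e).

  The inclusion for (f) holds because the weights \<open>max(0, |C \<inter> T| - 1)\<close> of (g) themselves belong to
  \<open>\<M>(N)\<close> (\<open>cluster_fun_extreme\<close>): a standardized supermodular function which is modular on every
  pair of sets on which this function is modular is a multiple of it.  Finally the set given by (d), (e), (f)
  is a polyhedron since a polyhedral cone has finitely many faces and all non-zero
  points of one ray impose the same constraint (f).
\<close>

section \<open>Vectors as divergences of flows\<close>

lemma sum_mult_delta:
  fixes w :: "'n::finite set \<Rightarrow> real"
  shows "(\<Sum>T\<in>UNIV. w T * delta A T) = w A"
  by (simp add: delta_def if_distrib[of "(*) _"] cong: if_cong)

lemma sum_of_bool_mult:
  fixes f :: "'a::finite \<Rightarrow> real"
  shows "(\<Sum>x\<in>UNIV. of_bool (x \<in> A) * f x) = sum f A"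
proof -
  have "(\<Sum>x\<in>UNIV. of_bool (x \<in> A) * f x) = (\<Sum>x\<in>UNIV. if x \<in> A then f x else 0)"
    by (rule sum.cong) auto
  then show ?thesis by (simp add: sum.If_cases)
qed

definition divergence :: "real ^ ('n::finite \<times> 'n set) \<Rightarrow> real ^ 'n set" where
  "divergence \<eta> = (\<chi> T. \<Sum>i\<in>UNIV. \<Sum>B\<in>Pow (UNIV - {i}).
      \<eta> $ (i, B) * (delta B T - delta ({i} \<union> B) T))"

lemma u_of_eq_divergence: "u_of \<eta> $ T = delta UNIV T - delta {} T + divergence \<eta> $ T"
  by (simp add: u_of_def divergence_def)

lemma linear_divergence: "linear divergence"
  by (rule linearI)
     (simp_all add: divergence_def vec_eq_iff sum.distrib distrib_right sum_distrib_left mult.assoc)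

text \<open>Summation by parts: a flow through the arc from \<open>B\<close> to \<open>{i} \<union> B\<close> contributes to the two
  end points only.\<close>

lemma sum_mult_divergence:
  "(\<Sum>T\<in>UNIV. w T * divergence \<eta> $ T) =
     (\<Sum>i\<in>UNIV. \<Sum>B\<in>Pow (UNIV - {i}). \<eta> $ (i, B) * (w B - w ({i} \<union> B)))"
proof -
  have "(\<Sum>T\<in>UNIV. w T * divergence \<eta> $ T) =
     (\<Sum>T\<in>UNIV. \<Sum>i\<in>UNIV. \<Sum>B\<in>Pow (UNIV - {i}).
        \<eta> $ (i, B) * (w T * delta B T - w T * delta ({i} \<union> B) T))"
    by (simp add: divergence_def sum_distrib_left algebra_simps)
  also have "\<dots> = (\<Sum>i\<in>UNIV. \<Sum>T\<in>UNIV. \<Sum>B\<in>Pow (UNIV - {i}).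
        \<eta> $ (i, B) * (w T * delta B T - w T * delta ({i} \<union> B) T))"
    by (rule sum.swap)
  also have "\<dots> = (\<Sum>i\<in>UNIV. \<Sum>B\<in>Pow (UNIV - {i}). \<Sum>T\<in>UNIV.
        \<eta> $ (i, B) * (w T * delta B T - w T * delta ({i} \<union> B) T))"
    by (intro sum.cong refl sum.swap)
  also have "\<dots> = (\<Sum>i\<in>UNIV. \<Sum>B\<in>Pow (UNIV - {i}). \<eta> $ (i, B) * (w B - w ({i} \<union> B)))"
    by (simp only: sum_distrib_left[symmetric] sum_subtractf sum_mult_delta)
  finally show ?thesis .
qed

lemma sum_mult_u_of:
  "(\<Sum>T\<in>UNIV. w T * u_of \<eta> $ T) = w UNIV - w {} +
     (\<Sum>i\<in>UNIV. \<Sum>B\<in>Pow (UNIV - {i}). \<eta> $ (i, B) * (w B - w ({i} \<union> B)))"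
  by (simp add: u_of_eq_divergence distrib_left right_diff_distrib sum.distrib sum_subtractf
      sum_mult_delta sum_mult_divergence)

text \<open>The components \<open>\<eta> $ (i, B)\<close> with \<open>i \<in> B\<close> belong to no arc and vanish.\<close>

definition flow_cone :: "(real ^ ('n::finite \<times> 'n set)) set" where
  "flow_cone = {\<eta> \<in> eta_space. \<forall>i. \<forall>B\<in>Pow (UNIV - {i}). \<eta> $ (i, B) \<ge> 0}"

lemma convex_cone_flow_cone: "convex_cone flow_cone"
  by (auto simp: convex_cone_iff flow_cone_def eta_space_def)

lemma sum_member_u_of:
  "(\<Sum>T | j \<in> T. u_of \<eta> $ T) = 1 - (\<Sum>B\<in>Pow (UNIV - {j}). \<eta> $ (j, B))"
proof -
  have "(\<Sum>B\<in>Pow (UNIV - {i}).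
          \<eta> $ (i, B) * (of_bool (B \<in> {T. j \<in> T}) - of_bool ({i} \<union> B \<in> {T. j \<in> T}))) =
      (if i = j then - (\<Sum>B\<in>Pow (UNIV - {j}). \<eta> $ (j, B)) else 0)" for i
    by (auto simp: sum_negf[symmetric] intro!: sum.cong sum.neutral)
  then have "(\<Sum>T\<in>UNIV. of_bool (T \<in> {T. j \<in> T}) * u_of \<eta> $ T) =
      1 - (\<Sum>B\<in>Pow (UNIV - {j}). \<eta> $ (j, B))"
    unfolding sum_mult_u_of by simp
  then show ?thesis unfolding sum_of_bool_mult .
qed

lemma sum_u_of: "(\<Sum>T\<in>UNIV. u_of \<eta> $ T) = 0"
  using sum_mult_u_of[of "\<lambda>_. 1" \<eta>] by simp

lemma sum_upset_u_of_le:
  fixes \<eta> :: "real ^ ('n::finite \<times> 'n set)"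
  assumes "\<eta> \<in> flow_cone" "A \<noteq> {}" "{} \<notin> A" "closed_under_supersets A"
  shows "(\<Sum>T\<in>A. u_of \<eta> $ T) \<le> 1"
proof -
  have up: "S \<in> A \<Longrightarrow> S \<subseteq> T \<Longrightarrow> T \<in> A" for S T
    using assms(4) unfolding closed_under_supersets_def by blast
  then have "UNIV \<in> A" using \<open>A \<noteq> {}\<close> by blast
  have "(\<Sum>i\<in>UNIV. \<Sum>B\<in>Pow (UNIV - {i}).
      \<eta> $ (i, B) * (of_bool (B \<in> A) - of_bool ({i} \<union> B \<in> A))) \<le> 0"
  proof (intro sum_nonpos mult_nonneg_nonpos)
    fix i :: 'n and B assume "B \<in> Pow (UNIV - {i})"
    then show "\<eta> $ (i, B) \<ge> 0" using assms(1) by (auto simp: flow_cone_def)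
    show "of_bool (B \<in> A) - of_bool ({i} \<union> B \<in> A) \<le> (0::real)"
      using up[of B "{i} \<union> B"] by auto
  qed
  then have "(\<Sum>T\<in>UNIV. of_bool (T \<in> A) * u_of \<eta> $ T) \<le> 1"
    unfolding sum_mult_u_of using \<open>UNIV \<in> A\<close> \<open>{} \<notin> A\<close> by simp
  then show ?thesis unfolding sum_of_bool_mult .
qed

section \<open>Existence of flows with prescribed divergence\<close>

text \<open>The layer-cake principle: a monotone function on a finite partially ordered set is a
  non-negative combination of indicators of up-sets, plus a constant.\<close>

lemma sum_mono_mult_nonpos:
  fixes f h :: "'a::{finite,order} \<Rightarrow> real"
  assumes up: "\<And>A. (\<And>x y. x \<in> A \<Longrightarrow> x \<le> y \<Longrightarrow> y \<in> A) \<Longrightarrow> sum f A \<le> 0"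
    and total: "sum f UNIV = 0"
    and "mono h"
  shows "(\<Sum>x\<in>UNIV. h x * f x) \<le> 0"
  using \<open>mono h\<close>
proof (induction "card (range h)" arbitrary: h rule: less_induct)
  case less
  define v where "v = Max (range h)"
  define A where "A = {x. h x = v}"
  have le_v: "h x \<le> v" for x by (simp add: v_def)
  show ?case
  proof (cases "range h = {v}")
    case True
    then have "h x = v" for x by blast
    then show ?thesis by (simp add: sum_distrib_left[symmetric] total)
  next
    case False
    have "v \<in> range h" unfolding v_def by (rule Max_in) auto
    with False have ne: "range h - {v} \<noteq> {}" by blast
    define v' where "v' = Max (range h - {v})"
    have v': "v' \<in> range h - {v}" unfolding v'_def using ne by (intro Max_in) auto
    have below: "h x \<le> v'" if "h x \<noteq> v" for x
      unfolding v'_def using that by (intro Max_ge) auto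
    \<comment> \<open>Lowering the top level \<open>v\<close> to the next level \<open>v'\<close> keeps \<open>h\<close> monotone, removes one value
      from its range, and changes the weighted sum by \<open>v - v'\<close> times the sum of \<open>f\<close> over an
      up-set.\<close>
    define h' where "h' x = min (h x) v'" for x
    have "v' < v" using v' le_v by (metis Diff_iff imageE insertCI order_le_less)
    have "mono h'" using less.prems unfolding h'_def mono_def by (metis min.mono order_refl)
    moreover have "card (range h') < card (range h)"
    proof (rule psubset_card_mono)
      have "range h' \<subseteq> range h - {v}"
        using v' below \<open>v' < v\<close> by (auto simp: h'_def min_def)
      then show "range h' \<subset> range h" using \<open>v \<in> range h\<close> by blast
    qed simp
    ultimately have IH: "(\<Sum>x\<in>UNIV. h' x * f x) \<le> 0" by (intro less.hyps)
    have "h x = h' x + (v - v') * of_bool (x \<in> A)" for x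
      using below[of x] \<open>v' < v\<close> by (auto simp: h'_def A_def)
    then have "(\<Sum>x\<in>UNIV. h x * f x) =
        (\<Sum>x\<in>UNIV. h' x * f x) + (v - v') * (\<Sum>x\<in>UNIV. of_bool (x \<in> A) * f x)"
      by (simp only: distrib_right sum.distrib sum_distrib_left mult.assoc)
    also have "(\<Sum>x\<in>UNIV. of_bool (x \<in> A) * f x) = sum f A"
      by (rule sum_of_bool_mult)
    finally have eq: "(\<Sum>x\<in>UNIV. h x * f x) = (\<Sum>x\<in>UNIV. h' x * f x) + (v - v') * sum f A" .
    have "sum f A \<le> 0"
    proof (rule up)
      fix x y assume "x \<in> A" "x \<le> y"
      then show "y \<in> A" using monoD[OF less.prems \<open>x \<le> y\<close>] le_v[of y] by (simp add: A_def)
    qed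
    with \<open>v' < v\<close> have "(v - v') * sum f A \<le> 0" by (simp add: mult_nonneg_nonpos)
    with IH eq show ?thesis by linarith
  qed
qed

text \<open>Farkas' lemma: a finitely generated cone is closed, so a point outside of it can be
  separated from it by a hyperplane, and by scaling the hyperplane may pass through the origin.\<close>

lemma convex_cone_hull_separation:
  fixes f :: "'a::euclidean_space"
  assumes "finite S" "f \<notin> convex_cone hull S"
  obtains a where "a \<bullet> f < 0" "\<And>x. x \<in> S \<Longrightarrow> a \<bullet> x \<ge> 0"
proof -
  obtain a b where a: "a \<bullet> f < b" "\<And>x. x \<in> convex_cone hull S \<Longrightarrow> b < a \<bullet> x"
    using separating_hyperplane_closed_point
      [OF convex_convex_cone_hull closed_convex_cone_hull[OF assms(1)] assms(2)] by blast
  have "b < 0" using a(2)[OF convex_cone_hull_contains_0] by simp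
  have "a \<bullet> x \<ge> 0" if "x \<in> S" for x
  proof (rule ccontr)
    assume neg: "\<not> a \<bullet> x \<ge> 0"
    \<comment> \<open>This multiple of \<open>x\<close> lies in the cone and on the separating hyperplane.\<close>
    have "b < a \<bullet> ((b / (a \<bullet> x)) *\<^sub>R x)"
      using that neg \<open>b < 0\<close>
      by (intro a(2) convex_cone_hull_mul hull_inc divide_nonpos_nonpos) auto
    then show False using neg by simp
  qed
  with a(1) \<open>b < 0\<close> that show ?thesis by force
qed

definition arc_vector :: "'n::finite \<Rightarrow> 'n set \<Rightarrow> real ^ 'n set" where
  "arc_vector i B = (\<chi> T. delta B T - delta ({i} \<union> B) T)"

lemma divergence_axis:
  assumes "i \<notin> B"
  shows "divergence (axis (i, B) 1) = arc_vector i B"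
proof -
  have "(\<Sum>D\<in>Pow (UNIV - {j}). axis (i, B) 1 $ (j, D) * (delta D T - delta ({j} \<union> D) T)) =
      (if j = i then delta B T - delta ({i} \<union> B) T else 0)" for j T
  proof -
    have "(\<Sum>D\<in>Pow (UNIV - {j}). axis (i, B) 1 $ (j, D) * (delta D T - delta ({j} \<union> D) T)) =
        (\<Sum>D\<in>Pow (UNIV - {j}). if D = B then of_bool (j = i) * (delta B T - delta ({i} \<union> B) T) else 0)"
      by (rule sum.cong) (auto simp: axis_def)
    then show ?thesis using assms by auto
  qed
  then show ?thesis by (simp add: divergence_def arc_vector_def vec_eq_iff)
qed

lemma inner_arc_vector: "a \<bullet> arc_vector i B = a $ B - a $ ({i} \<union> B)"
  by (simp add: inner_vec_def arc_vector_def right_diff_distrib sum_subtractf sum_mult_delta)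

lemma antitone_if_insert_le:
  fixes g :: "'n::finite set \<Rightarrow> real"
  assumes "\<And>i B. i \<notin> B \<Longrightarrow> g ({i} \<union> B) \<le> g B" and "S \<subseteq> T"
  shows "g T \<le> g S"
proof -
  have "g (S \<union> D) \<le> g S" for D
  proof (induction D rule: finite_induct[OF finite])
    case (2 x F)
    show ?case
      using assms(1)[of x "S \<union> F"] 2 by (cases "x \<in> S \<union> F") (auto simp: insert_absorb)
  qed simp
  from this[of T] \<open>S \<subseteq> T\<close> show ?thesis by (simp add: Un_absorb1)
qed

text \<open>Gale's theorem for the uncapacitated graph of all subsets: demands that sum to zero can be
  met if no up-set, that is no set of vertices without outgoing arcs, has a positive net
  supply.\<close>

lemma divergence_surj:
  fixes f :: "real ^ 'n::finite set"
  assumes total: "(\<Sum>T\<in>UNIV. f $ T) = 0"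
    and up: "\<And>A. A \<noteq> {} \<Longrightarrow> {} \<notin> A \<Longrightarrow> closed_under_supersets A \<Longrightarrow> (\<Sum>T\<in>A. f $ T) \<le> 0"
  obtains \<eta> where "\<eta> \<in> flow_cone" "divergence \<eta> = f"
proof -
  define X where "X = (\<lambda>(i, B). arc_vector i B) ` {(i :: 'n, B). i \<notin> B}"
  have "f \<in> convex_cone hull X"
  proof (rule ccontr)
    assume "f \<notin> convex_cone hull X"
    moreover have "finite X" by (simp add: X_def)
    ultimately obtain a where a: "a \<bullet> f < 0" "\<And>x. x \<in> X \<Longrightarrow> a \<bullet> x \<ge> 0"
      using convex_cone_hull_separation by blast
    have "a $ ({i} \<union> B) \<le> a $ B" if "i \<notin> B" for i B
      using a(2)[of "arc_vector i B"] that by (auto simp: X_def inner_arc_vector)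
    then have "mono (\<lambda>T. - a $ T)"
      by (intro monoI) (simp add: antitone_if_insert_le)
    moreover have "(\<Sum>T\<in>A. f $ T) \<le> 0" if "\<And>S T. S \<in> A \<Longrightarrow> S \<subseteq> T \<Longrightarrow> T \<in> A" for A
    proof (cases "A = {} \<or> {} \<in> A")
      case True
      then have "A = {} \<or> A = UNIV" using that by blast
      then show ?thesis using total by auto
    next
      case False
      have "closed_under_supersets A" using that unfolding closed_under_supersets_def by blast
      then show ?thesis using False up by blast
    qed
    ultimately have "(\<Sum>T\<in>UNIV. - a $ T * f $ T) \<le> 0"
      using total by (intro sum_mono_mult_nonpos) auto
    then show False using a(1) by (simp add: inner_vec_def sum_negf)
  qed
  also have "convex_cone hull X \<subseteq> divergence ` flow_cone"
  proof (rule hull_minimal)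
    show "convex_cone (divergence ` flow_cone :: (real ^ 'n set) set)"
      using convex_cone_flow_cone linear_divergence by (intro convex_cone_linear_image conjI)
    show "X \<subseteq> divergence ` flow_cone"
    proof (clarsimp simp: X_def)
      fix i :: 'n and B assume "i \<notin> B"
      then have "axis (i, B) 1 \<in> flow_cone"
        by (auto simp: flow_cone_def eta_space_def axis_def)
      then show "arc_vector i B \<in> divergence ` flow_cone"
        using divergence_axis[OF \<open>i \<notin> B\<close>] by (metis imageI)
    qed
  qed
  finally show ?thesis using that by blast
qed

section \<open>Cluster inequalities\<close>

text \<open>The weights of constraint (g); the truncated subtraction yields the maximum with 0.\<close>

definition cluster_fun :: "'n::finite set \<Rightarrow> real ^ 'n set" where
  "cluster_fun C = (\<chi> T. real (card (C \<inter> T) - 1))"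

lemma cluster_constraints_iff:
  "cluster_constraints u \<longleftrightarrow> (\<forall>C. card C \<ge> 2 \<longrightarrow> (\<Sum>T\<in>UNIV. cluster_fun C $ T * u $ T) \<ge> 0)"
proof -
  have "(\<Sum>T | card (C \<inter> T) \<ge> 2. u $ T * (real (card (C \<inter> T)) - 1)) =
      (\<Sum>T\<in>UNIV. cluster_fun C $ T * u $ T)" for C
    by (rule sum.mono_neutral_cong_left) (auto simp: cluster_fun_def not_le of_nat_diff)
  then show ?thesis by (simp add: cluster_constraints_def)
qed

lemma cluster_fun_insert:
  assumes "i \<notin> B"
  shows "cluster_fun C $ B - cluster_fun C $ insert i B =
    of_bool (i \<in> C \<and> B \<subseteq> UNIV - C) - of_bool (i \<in> C)"
proof (cases "i \<in> C")
  case True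
  then have "C \<inter> insert i B = insert i (C \<inter> B)" by blast
  then have c: "card (C \<inter> insert i B) = Suc (card (C \<inter> B))" using assms by simp
  have "card (C \<inter> B) = 0 \<longleftrightarrow> B \<subseteq> UNIV - C" by auto
  then show ?thesis using True c
    by (cases "card (C \<inter> B)") (auto simp: cluster_fun_def)
next
  case False
  then have "C \<inter> insert i B = C \<inter> B" by blast
  with False show ?thesis by (simp add: cluster_fun_def)
qed

text \<open>Along an arc from \<open>B\<close> to \<open>{i} \<union> B\<close> with \<open>i \<in> C\<close> the weight increases by 1, except when the
  arc adds the first element of \<open>C\<close>.  Under (b) the total flow on arcs that add a given element
  is 1, and what remains are the exceptional arcs, counted in (c).\<close>

lemma sum_cluster_fun_u_of:
  assumes "C \<noteq> {}" and norm: "\<And>j. (\<Sum>B\<in>Pow (UNIV - {j}). \<eta> $ (j, B)) = 1"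
  shows "(\<Sum>T\<in>UNIV. cluster_fun C $ T * u_of \<eta> $ T) =
    (\<Sum>i\<in>C. \<Sum>D\<in>Pow (UNIV - C). \<eta> $ (i, D)) - 1"
proof -
  have "(\<Sum>B\<in>Pow (UNIV - {i}). \<eta> $ (i, B) * (cluster_fun C $ B - cluster_fun C $ ({i} \<union> B))) =
      (if i \<in> C then (\<Sum>D\<in>Pow (UNIV - C). \<eta> $ (i, D)) - 1 else 0)" for i
  proof -
    have "(\<Sum>B\<in>Pow (UNIV - {i}). \<eta> $ (i, B) * (cluster_fun C $ B - cluster_fun C $ ({i} \<union> B))) =
      (\<Sum>B\<in>Pow (UNIV - {i}). \<eta> $ (i, B) * of_bool (i \<in> C \<and> B \<subseteq> UNIV - C)
          - \<eta> $ (i, B) * of_bool (i \<in> C))"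
    proof (rule sum.cong)
      fix B assume "B \<in> Pow (UNIV - {i})"
      then have "i \<notin> B" by blast
      from cluster_fun_insert[OF this, of C]
      show "\<eta> $ (i, B) * (cluster_fun C $ B - cluster_fun C $ ({i} \<union> B)) =
          \<eta> $ (i, B) * of_bool (i \<in> C \<and> B \<subseteq> UNIV - C) - \<eta> $ (i, B) * of_bool (i \<in> C)"
        by (simp only: insert_is_Un[symmetric] right_diff_distrib)
    qed simp
    also have "\<dots> = (\<Sum>B\<in>Pow (UNIV - {i}). \<eta> $ (i, B) * of_bool (i \<in> C \<and> B \<subseteq> UNIV - C)) - of_bool (i \<in> C)"
      by (simp add: sum_subtractf sum_distrib_right[symmetric] norm del: of_bool_conj)
    also have "(\<Sum>B\<in>Pow (UNIV - {i}). \<eta> $ (i, B) * of_bool (i \<in> C \<and> B \<subseteq> UNIV - C)) =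
        (if i \<in> C then \<Sum>D\<in>Pow (UNIV - C). \<eta> $ (i, D) else 0)"
      by (auto intro!: sum.mono_neutral_cong_right)
    finally show ?thesis by simp
  qed
  then have "(\<Sum>T\<in>UNIV. cluster_fun C $ T * u_of \<eta> $ T) =
     real (card C - 1) + (\<Sum>i\<in>C. (\<Sum>D\<in>Pow (UNIV - C). \<eta> $ (i, D)) - 1)"
    by (simp add: sum_mult_u_of cluster_fun_def sum.If_cases)
  also have "real (card C - 1) = real (card C) - 1"
    using \<open>C \<noteq> {}\<close> by (simp add: of_nat_diff card_gt_0_iff Suc_le_eq)
  finally show ?thesis by (simp add: sum_subtractf)
qed

theorem image_J_polyhedron:
  "u_of ` (J_polyhedron :: (real ^ ('n::finite \<times> 'n set)) set) =
     {u. zero_sum_constraints u \<and> superset_class_constraints u \<and> cluster_constraints u}"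
proof (intro equalityI subsetI)
  fix u assume "u \<in> u_of ` (J_polyhedron :: (real ^ ('n \<times> 'n set)) set)"
  then obtain \<eta> where \<eta>: "\<eta> \<in> J_polyhedron" "u = u_of \<eta>" by blast
  then have norm: "\<And>j. (\<Sum>B\<in>Pow (UNIV - {j}). \<eta> $ (j, B)) = 1"
    and flow: "\<eta> \<in> flow_cone"
    and cl: "\<And>C. card C \<ge> 2 \<Longrightarrow> (\<Sum>i\<in>C. \<Sum>D\<in>Pow (UNIV - C). \<eta> $ (i, D)) \<ge> 1"
    by (simp_all add: J_polyhedron_def flow_cone_def)
  have "cluster_constraints u"
    unfolding cluster_constraints_iff
  proof (intro allI impI)
    fix C :: "'n set" assume "card C \<ge> 2"
    moreover from this have "C \<noteq> {}" by auto
    ultimately show "(\<Sum>T\<in>UNIV. cluster_fun C $ T * u $ T) \<ge> 0"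
      using cl[of C] by (simp add: \<eta>(2) sum_cluster_fun_u_of norm)
  qed
  moreover have "zero_sum_constraints u"
    by (simp add: zero_sum_constraints_def \<eta>(2) sum_u_of sum_member_u_of norm)
  moreover have "superset_class_constraints u"
    using sum_upset_u_of_le[OF flow] by (simp add: superset_class_constraints_def \<eta>(2))
  ultimately show "u \<in> {u. zero_sum_constraints u \<and> superset_class_constraints u \<and> cluster_constraints u}"
    by simp
next
  fix u :: "real ^ 'n set"
  assume "u \<in> {u. zero_sum_constraints u \<and> superset_class_constraints u \<and> cluster_constraints u}"
  then have zero: "(\<Sum>T\<in>UNIV. u $ T) = 0" "\<And>j. (\<Sum>T | j \<in> T. u $ T) = 0"
    and up: "\<And>A. A \<noteq> {} \<Longrightarrow> {} \<notin> A \<Longrightarrow> closed_under_supersets A \<Longrightarrow> (\<Sum>T\<in>A. u $ T) \<le> 1"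
    and cl: "\<And>C. card C \<ge> 2 \<Longrightarrow> (\<Sum>T\<in>UNIV. cluster_fun C $ T * u $ T) \<ge> 0"
    by (auto simp: zero_sum_constraints_def superset_class_constraints_def cluster_constraints_iff)
  \<comment> \<open>A flow with divergence \<open>f\<close> carries one unit from the empty set to \<open>N\<close> when \<open>u = 0\<close>; (e) is the
    condition for its existence.\<close>
  define f :: "real ^ 'n set" where "f = (\<chi> T. u $ T - delta UNIV T + delta {} T)"
  have sum_f: "(\<Sum>T\<in>A. f $ T) = (\<Sum>T\<in>A. u $ T) - of_bool (UNIV \<in> A) + of_bool ({} \<in> A)" for A
    by (simp add: f_def delta_def sum.distrib sum_subtractf)
  obtain \<eta> where \<eta>: "\<eta> \<in> flow_cone" "divergence \<eta> = f"
  proof (rule divergence_surj)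
    show "(\<Sum>T\<in>UNIV. f $ T) = 0" by (simp add: sum_f zero)
    fix A :: "'n set set" assume A: "A \<noteq> {}" "{} \<notin> A" "closed_under_supersets A"
    then have "UNIV \<in> A" unfolding closed_under_supersets_def by blast
    then show "(\<Sum>T\<in>A. f $ T) \<le> 0" using up[OF A] A(2) by (simp add: sum_f)
  qed
  then have u: "u_of \<eta> = u" by (simp add: vec_eq_iff u_of_eq_divergence f_def)
  have norm: "(\<Sum>B\<in>Pow (UNIV - {j}). \<eta> $ (j, B)) = 1" for j
    using sum_member_u_of[of \<eta> j] zero(2)[of j] by (simp add: u)
  have "(\<Sum>i\<in>C. \<Sum>D\<in>Pow (UNIV - C). \<eta> $ (i, D)) \<ge> 1" if "card C \<ge> 2" for C
  proof -
    from that have "C \<noteq> {}" by auto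
    from sum_cluster_fun_u_of[OF this norm] cl[OF that] show ?thesis by (simp add: u)
  qed
  then have "\<eta> \<in> J_polyhedron" using \<eta>(1) norm by (simp add: J_polyhedron_def flow_cone_def)
  then show "u \<in> u_of ` J_polyhedron" using u by blast
qed

section \<open>Cluster functions as extreme supermodular functions\<close>

text \<open>A pair of sets is called modular for \<open>m\<close> if its slack is 0.\<close>

definition slack :: "real ^ 'n::finite set \<Rightarrow> 'n set \<Rightarrow> 'n set \<Rightarrow> real" where
  "slack m E F = m $ (E \<union> F) + m $ (E \<inter> F) - m $ E - m $ F"

lemma slack_nonneg: "m \<in> supermodular_cone \<Longrightarrow> slack m E F \<ge> 0"
  by (simp add: supermodular_cone_def supermodular_def slack_def algebra_simps)

lemma slack_scaleR: "slack (c *\<^sub>R m) E F = c * slack m E F"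
  by (simp add: slack_def algebra_simps)

lemma slack_add: "slack (m + m') E F = slack m E F + slack m' E F"
  by (simp add: slack_def)

lemma cluster_fun_in_supermodular_cone: "cluster_fun C \<in> supermodular_cone"
proof -
  have "(card (C \<inter> E) - 1) + (card (C \<inter> F) - 1)
      \<le> (card (C \<inter> (E \<union> F)) - 1) + (card (C \<inter> (E \<inter> F)) - 1)" for E F
  proof -
    have "card (C \<inter> E) + card (C \<inter> F) = card (C \<inter> (E \<union> F)) + card (C \<inter> (E \<inter> F))"
      using card_Un_Int[of "C \<inter> E" "C \<inter> F"] by (simp add: Int_Un_distrib Int_ac)
    moreover have "card (C \<inter> (E \<inter> F)) \<le> card (C \<inter> E)" "card (C \<inter> (E \<inter> F)) \<le> card (C \<inter> F)"
      by (auto intro!: card_mono)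
    ultimately show ?thesis by linarith
  qed
  then have "supermodular (cluster_fun C)"
    by (simp add: supermodular_def cluster_fun_def flip: of_nat_add)
  moreover have "card (C \<inter> T) \<le> card T" for T by (auto intro!: card_mono)
  then have "standardized (cluster_fun C)"
    by (auto simp: standardized_def cluster_fun_def intro: le_trans)
  ultimately show ?thesis by (simp add: supermodular_cone_def)
qed

text \<open>A pair \<open>T, {i}\<close> with \<open>i \<notin> C\<close> is modular for the cluster function, and so is
  \<open>T, {x, i}\<close> with \<open>x \<in> T\<close> and \<open>x, i \<in> C\<close>.  The first kind of pairs shows that \<open>m\<close> depends on
  \<open>C \<inter> T\<close> only; the second kind shows that adding an element of \<open>C\<close> to a set that meets \<open>C\<close>
  increases \<open>m\<close> by a constant amount.\<close>

lemma multiple_of_cluster_fun_if_slack_0: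
  assumes m: "m \<in> supermodular_cone" and C: "card C \<ge> 2"
    and tight: "\<And>E F. slack (cluster_fun C) E F = 0 \<Longrightarrow> slack m E F = 0"
  shows "\<exists>k\<ge>0. m = k *\<^sub>R cluster_fun C"
proof -
  have std: "m $ T = 0" if "card T \<le> 1" for T
    using m that by (simp add: supermodular_cone_def standardized_def)
  have outside: "m $ insert i T = m $ T" if "i \<notin> C" for i T
  proof (cases "i \<in> T")
    case False
    with that have "slack (cluster_fun C) T {i} = 0"
      by (simp add: slack_def cluster_fun_def)
    from tight[OF this] False show ?thesis by (simp add: slack_def std)
  qed (simp add: insert_absorb)
  have step: "m $ insert i T = m $ T + m $ {x, i}"
    if "x \<in> C" "x \<in> T" "i \<in> C" "i \<notin> T" for x i T
  proof -
    have eqs: "T \<union> {x, i} = insert i T" "T \<inter> {x, i} = {x}"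
      using that by auto
    have "C \<inter> insert i T = insert i (C \<inter> T)" "C \<inter> {x, i} = {x, i}" "C \<inter> {x} = {x}" "x \<noteq> i"
      using that by auto
    then have cards: "card (C \<inter> insert i T) = Suc (card (C \<inter> T))" "card (C \<inter> {x, i}) = 2"
        "card (C \<inter> {x}) = 1"
      using that by simp_all
    have "card (C \<inter> T) > 0" using that by (auto simp: card_gt_0_iff)
    then have "slack (cluster_fun C) T {x, i} = 0"
      unfolding slack_def eqs cluster_fun_def vec_lambda_beta cards by (simp add: of_nat_diff)
    from tight[OF this] show ?thesis unfolding slack_def eqs by (simp add: std)
  qed
  obtain a b where ab: "a \<in> C" "b \<in> C" "a \<noteq> b"
    using C by (metis One_nat_def card_le_Suc0_iff_eq finite not_less_eq_eq numeral_2_eq_2)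
  define k where "k = m $ {a, b}"
  have swap: "m $ {x, z} = m $ {y, z}"
    if "x \<in> C" "y \<in> C" "z \<in> C" "x \<noteq> z" "y \<noteq> z" for x y z
    using step[of x "{x, y}" z] step[of y "{x, y}" z] that by simp
  have k_a: "m $ {a, y} = k" if "y \<in> C" "y \<noteq> a" for y
    using swap[of y b a] that ab by (simp add: k_def insert_commute)
  have pair: "m $ {x, y} = k" if "x \<in> C" "y \<in> C" "x \<noteq> y" for x y
  proof (cases "y = a")
    case True
    then show ?thesis using k_a[of x] that by (simp add: insert_commute)
  next
    case False
    then show ?thesis using swap[of x a y] k_a[of y] that ab by simp
  qed
  have inside: "m $ T = k * real (card T - 1)" if "T \<subseteq> C" for T
    using finite[of T] that
  proof (induction T rule: finite_induct)
    case empty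
    then show ?case by (simp add: std)
  next
    case (insert i F)
    show ?case
    proof (cases "F = {}")
      case True
      then show ?thesis by (simp add: std)
    next
      case False
      then obtain x where x: "x \<in> F" by blast
      with insert have "m $ insert i F = k * real (card F - 1) + k"
        by (subst step[of x]) (auto intro!: pair)
      moreover have "card F > 0" using False by (simp add: card_gt_0_iff)
      ultimately show ?thesis using insert by (simp add: of_nat_diff Suc_le_eq algebra_simps)
    qed
  qed
  have "m $ (S \<union> D) = m $ S" if "D \<inter> C = {}" for S D
    using finite[of D] that
    by (induction D rule: finite_induct) (auto simp: outside)
  from this[of "T - C" "C \<inter> T" for T] have "m $ T = m $ (C \<inter> T)" for T
    by (metis Diff_Int_distrib2 Diff_cancel Int_Diff Int_Diff_Un Int_commute Int_empty_right)
  then have "m $ T = k * cluster_fun C $ T" for T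
    using inside[of "C \<inter> T"] by (simp add: cluster_fun_def)
  moreover have "k \<ge> 0"
    using slack_nonneg[OF m, of "{a}" "{b}"] ab by (simp add: slack_def std k_def insert_commute)
  ultimately show ?thesis by (auto simp: vec_eq_iff)
qed

text \<open>If a sum of supermodular functions is modular on a pair of sets, then so are the summands,
  because slacks add up and are non-negative.\<close>

lemma cluster_ray_face_of:
  assumes C: "card C \<ge> 2"
  shows "(conic hull {cluster_fun C}) face_of supermodular_cone"
  unfolding face_of_def
proof (intro conjI ballI impI)
  show "conic hull {cluster_fun C} \<subseteq> supermodular_cone"
  proof (clarsimp simp: conic_hull_explicit)
    fix c :: real assume "c \<ge> 0"
    with cluster_fun_in_supermodular_cone[of C] show "c *\<^sub>R cluster_fun C \<in> supermodular_cone"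
      by (auto simp: supermodular_cone_def standardized_def supermodular_def mult_left_mono
          simp flip: distrib_left)
  qed
  show "convex (conic hull {cluster_fun C})" by (simp add: convex_conic_hull)
next
  have multiple: "p \<in> conic hull {cluster_fun C}"
    if p: "p \<in> supermodular_cone" and q: "q \<in> supermodular_cone"
      and u: "0 < u" "0 \<le> v" and eq: "u *\<^sub>R p + v *\<^sub>R q = c *\<^sub>R cluster_fun C" for p q u v c
  proof -
    have "slack p E F = 0" if "slack (cluster_fun C) E F = 0" for E F
    proof -
      have "u * slack p E F + v * slack q E F = c * slack (cluster_fun C) E F"
        using arg_cong[OF eq, of "\<lambda>m. slack m E F"] by (simp add: slack_add slack_scaleR)
      moreover have "u * slack p E F \<ge> 0" "v * slack q E F \<ge> 0"
        using u slack_nonneg[OF p] slack_nonneg[OF q] by simp_all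
      ultimately have "u * slack p E F = 0" unfolding that by linarith
      then show ?thesis using u by simp
    qed
    from multiple_of_cluster_fun_if_slack_0[OF p C this] show ?thesis
      by (auto simp: conic_hull_explicit)
  qed
  fix p q x
  assume pq: "p \<in> supermodular_cone" "q \<in> supermodular_cone"
    and x: "x \<in> conic hull {cluster_fun C}" "x \<in> open_segment p q"
  then obtain u c where u: "0 < u" "u < 1" "(1 - u) *\<^sub>R p + u *\<^sub>R q = c *\<^sub>R cluster_fun C"
    by (smt (verit) in_segment(2) conic_hull_explicit mem_Collect_eq singletonD)
  then show "p \<in> conic hull {cluster_fun C}" using multiple[of p q "1 - u" u c] pq by simp
  show "q \<in> conic hull {cluster_fun C}"
    using multiple[of q p u "1 - u" c] pq u by (simp add: add.commute)
qed

lemma cluster_fun_extreme: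
  assumes "card C \<ge> 2"
  shows "cluster_fun C \<in> extreme_supermodular"
proof -
  obtain a b where ab: "a \<in> C" "b \<in> C" "a \<noteq> b"
    using assms by (metis One_nat_def card_le_Suc0_iff_eq finite not_less_eq_eq numeral_2_eq_2)
  have "C \<inter> {a, b} = {a, b}" using ab by blast
  \<comment> \<open>A component equal to 1 leaves no common prime divisor.\<close>
  with ab have card1: "card (C \<inter> {a, b}) - 1 = 1" by simp
  then have "cluster_fun C $ {a, b} \<noteq> 0" unfolding cluster_fun_def vec_lambda_beta by simp
  then have nz: "cluster_fun C \<noteq> 0" by auto
  have "\<not> (\<exists>p. prime p \<and> (\<forall>T. p dvd int (card (C \<inter> T) - 1)))"
  proof
    assume "\<exists>p. prime p \<and> (\<forall>T. p dvd int (card (C \<inter> T) - 1))"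
    then obtain p :: int where "prime p" "p dvd int (card (C \<inter> {a, b}) - 1)" by blast
    then have "p dvd 1" unfolding card1 by simp
    with \<open>prime p\<close> show False using not_prime_unit by blast
  qed
  moreover have "\<forall>T. cluster_fun C $ T = of_int (int (card (C \<inter> T) - 1))"
    by (simp add: cluster_fun_def)
  ultimately have "primitive_lattice_point (cluster_fun C)"
    unfolding primitive_lattice_point_def using nz
    by (intro conjI exI[of _ "\<lambda>T. int (card (C \<inter> T) - 1)"])
  moreover have "(conic hull {cluster_fun C}) extreme_ray_of supermodular_cone"
    unfolding extreme_ray_of_def using cluster_ray_face_of[OF assms] nz by blast
  moreover have "cluster_fun C \<in> conic hull {cluster_fun C}" by (simp add: hull_inc)
  ultimately show ?thesis unfolding extreme_supermodular_def by blast
qed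

lemma cluster_constraints_if_supermodular_constraints:
  "supermodular_constraints u \<Longrightarrow> cluster_constraints u"
  by (simp add: supermodular_constraints_def cluster_constraints_iff cluster_fun_extreme)

section \<open>Polyhedrality\<close>

lemma polyhedron_Collect_ball:
  assumes "finite I" "\<And>i. i \<in> I \<Longrightarrow> polyhedron {x. P i x}"
  shows "polyhedron {x. \<forall>i\<in>I. P i x}"
proof -
  have "{x. \<forall>i\<in>I. P i x} = \<Inter> ((\<lambda>i. {x. P i x}) ` I)" by auto
  then show ?thesis using assms by (auto intro!: polyhedron_Inter)
qed

lemma polyhedron_Collect_sum_le:
  fixes c :: "'k::finite \<Rightarrow> real"
  shows "polyhedron {x :: real ^ 'k. (\<Sum>k\<in>UNIV. c k * x $ k) \<le> b}"
  using polyhedron_halfspace_le[of "\<chi> k. c k" b] by (simp add: inner_vec_def)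

lemma polyhedron_Collect_sum_ge:
  fixes c :: "'k::finite \<Rightarrow> real"
  shows "polyhedron {x :: real ^ 'k. (\<Sum>k\<in>UNIV. c k * x $ k) \<ge> b}"
  using polyhedron_halfspace_ge[where a = "\<chi> k. c k" and b = b] by (simp add: inner_vec_def)

lemma polyhedron_Collect_conj:
  assumes "polyhedron {x. P x}" "polyhedron {x. Q x}"
  shows "polyhedron {x. P x \<and> Q x}"
  using polyhedron_Int[OF assms] by (simp add: Collect_conj_eq)

lemma polyhedron_Collect_sum_eq:
  fixes c :: "'k::finite \<Rightarrow> real"
  shows "polyhedron {x :: real ^ 'k. (\<Sum>k\<in>UNIV. c k * x $ k) = b}"
  using polyhedron_hyperplane[where a = "\<chi> k. c k" and b = b] by (simp add: inner_vec_def)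

lemma polyhedron_zero_sum: "polyhedron {u :: real ^ 'n::finite set. zero_sum_constraints u}"
proof -
  have "{u :: real ^ 'n set. zero_sum_constraints u} =
      {u. (\<Sum>T\<in>UNIV. 1 * u $ T) = 0 \<and> (\<forall>j\<in>UNIV. (\<Sum>T\<in>UNIV. of_bool (T \<in> {T. j \<in> T}) * u $ T) = 0)}"
    unfolding sum_of_bool_mult by (simp add: zero_sum_constraints_def)
  then show ?thesis
    by (simp only:) (intro polyhedron_Collect_conj polyhedron_Collect_ball
        polyhedron_Collect_sum_eq finite)
qed

lemma polyhedron_superset_class: "polyhedron {u :: real ^ 'n::finite set. superset_class_constraints u}"
proof -
  have "{u :: real ^ 'n set. superset_class_constraints u} =
      {u. \<forall>A\<in>{A. A \<noteq> {} \<and> {} \<notin> A \<and> closed_under_supersets A}.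
         (\<Sum>T\<in>UNIV. of_bool (T \<in> A) * u $ T) \<le> 1}"
    unfolding sum_of_bool_mult by (simp add: superset_class_constraints_def)
  then show ?thesis
    by (simp only:) (intro polyhedron_Collect_ball polyhedron_Collect_sum_le finite)
qed

lemma polyhedron_cluster: "polyhedron {u :: real ^ 'n::finite set. cluster_constraints u}"
proof -
  have "{u :: real ^ 'n set. cluster_constraints u} =
      {u. \<forall>C\<in>{C. card C \<ge> 2}. (\<Sum>T\<in>UNIV. cluster_fun C $ T * u $ T) \<ge> 0}"
    by (simp add: cluster_constraints_iff)
  then show ?thesis
    by (simp only:) (intro polyhedron_Collect_ball polyhedron_Collect_sum_ge finite)
qed

lemma polyhedron_supermodular_cone: "polyhedron (supermodular_cone :: (real ^ 'n::finite set) set)"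
proof -
  let ?w = "\<lambda>(E, F) T. delta (E \<union> F) T + delta (E \<inter> F) T - delta E T - delta F (T :: 'n set)"
  have pick: "(\<Sum>T\<in>UNIV. delta A T * m $ T) = m $ A" for A and m :: "real ^ 'n set"
    using sum_mult_delta[of "\<lambda>T. m $ T" A] by (simp add: mult.commute)
  have "(supermodular_cone :: (real ^ 'n set) set) =
      {m. (\<forall>A\<in>{A. card A \<le> 1}. (\<Sum>T\<in>UNIV. delta A T * m $ T) = 0) \<and>
          (\<forall>p\<in>UNIV. (\<Sum>T\<in>UNIV. ?w p T * m $ T) \<ge> 0)}"
    by (auto simp: supermodular_cone_def standardized_def supermodular_def distrib_right
        left_diff_distrib sum.distrib sum_subtractf pick algebra_simps simp del: mult.commute)
  then show ?thesis
    by (rule ssubst) (intro polyhedron_Collect_conj polyhedron_Collect_ball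
        polyhedron_Collect_sum_eq polyhedron_Collect_sum_ge finite)
qed

text \<open>Every non-zero point of a ray spans the ray, so the half-space of a constraint in (f) is
  determined by the extreme ray on which \<open>m\<close> lies, and there are finitely many extreme rays.\<close>

lemma polyhedron_supermodular_constraints:
  "polyhedron {u :: real ^ 'n::finite set. supermodular_constraints u}"
proof -
  let ?H = "\<lambda>m :: real ^ 'n set. {u. (\<Sum>T\<in>UNIV. m $ T * u $ T) \<ge> 0}"
  let ?dual = "\<lambda>R :: (real ^ 'n set) set. {u. \<forall>m\<in>R. m \<bullet> u \<ge> 0}"
  have "?H ` extreme_supermodular \<subseteq> ?dual ` {R. R face_of supermodular_cone}"
  proof (rule image_subsetI)
    fix m :: "real ^ 'n set" assume "m \<in> extreme_supermodular"
    then obtain R x where R: "R face_of supermodular_cone" "m \<in> R" "R = conic hull {x}"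
      and "m \<noteq> 0"
      by (auto simp: extreme_supermodular_def primitive_lattice_point_def extreme_ray_of_def)
    then obtain c where c: "m = c *\<^sub>R x" "c > 0" by (auto simp: conic_hull_explicit less_le)
    have "?H m = {u. m \<bullet> u \<ge> 0}" by (simp add: inner_vec_def)
    also have "\<dots> = {u. x \<bullet> u \<ge> 0}" using c by (simp add: zero_le_mult_iff)
    also have "\<dots> = ?dual R"
    proof (intro Collect_cong iffI ballI)
      fix u m assume "x \<bullet> u \<ge> 0" "m \<in> R"
      then show "m \<bullet> u \<ge> 0" by (auto simp: R(3) conic_hull_explicit)
    next
      fix u assume "\<forall>m\<in>R. m \<bullet> u \<ge> 0"
      then show "x \<bullet> u \<ge> 0" by (simp add: R(3) hull_inc)
    qed
    finally show "?H m \<in> ?dual ` {R. R face_of supermodular_cone}" using R(1) by blast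
  qed
  then have "finite (?H ` extreme_supermodular)"
    by (rule finite_subset) (simp add: finite_polyhedron_faces polyhedron_supermodular_cone)
  then have "polyhedron (\<Inter> (?H ` extreme_supermodular))"
    by (rule polyhedron_Inter) (auto intro: polyhedron_Collect_sum_ge)
  also have "\<Inter> (?H ` extreme_supermodular) = {u. supermodular_constraints u}"
    by (auto simp: supermodular_constraints_def)
  finally show ?thesis .
qed

section \<open>The polyhedral image\<close>

theorem corollary19:
  assumes "CARD('n::finite) \<ge> 2"
  shows "u_of ` (J_polyhedron :: (real ^ ('n \<times> 'n set)) set) =
           {u. zero_sum_constraints u \<and> superset_class_constraints u \<and> cluster_constraints u} \<and>
         polyhedron {u :: real ^ 'n set.
           zero_sum_constraints u \<and> superset_class_constraints u \<and> cluster_constraints u} \<and>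
         {u. zero_sum_constraints u \<and> superset_class_constraints u \<and> supermodular_constraints u} \<subseteq>
           u_of ` (J_polyhedron :: (real ^ ('n \<times> 'n set)) set) \<and>
         polyhedron {u :: real ^ 'n set.
           zero_sum_constraints u \<and> superset_class_constraints u \<and> supermodular_constraints u}"
proof (intro conjI)
  show "u_of ` (J_polyhedron :: (real ^ ('n \<times> 'n set)) set) =
      {u. zero_sum_constraints u \<and> superset_class_constraints u \<and> cluster_constraints u}"
    by (rule image_J_polyhedron)
  show "{u. zero_sum_constraints u \<and> superset_class_constraints u \<and> supermodular_constraints u} \<subseteq>
      u_of ` (J_polyhedron :: (real ^ ('n \<times> 'n set)) set)"
    unfolding image_J_polyhedron using cluster_constraints_if_supermodular_constraints by blast
qed (intro polyhedron_Collect_conj polyhedron_zero_sum polyhedron_superset_class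
    polyhedron_cluster polyhedron_supermodular_constraints)+

end
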